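(* Let $G$ be a spatial graph and let $D$ be a planar stick diagram of $G$ with exactly ${\operatorname{pl}}[G]$ sticks. For each integer $d\ge 0$, let $n_d$ be the number of sticks $e$ of $D$ such that exactly $d$ other sticks share an endpoint (vertex) with $e$. Then \[ {\operatorname{cr}}[G] \leq \frac{1}{2}\sum_{d} n_d\,\bigl({\operatorname{pl}}[G]-d-1\bigr). \]
   Context: A spatial graph is an embedding of a graph in $\mathbb{R}^3$ up to ambient isotopy, equivalently a spatial graph diagram up to the graph Reidemeister moves R1–R6. A planar stick diagram of $G$ is a spatial graph diagram of $G$ (generic planar immersion, transverse double points decorated as crossings, no vertex image meeting another vertex image or the interior of an edge) in which every edge is a straight segment (a "stick"), where edges of the underlying graph may be subdivided by degree-2 vertices. The planar stick index ${\operatorname{pl}}[G]$ is the minimum number of sticks in a planar stick diagram of $G$. The crossing number ${\operatorname{cr}}[G]$ is the minimum number of crossings over all spatial graph diagrams of $G$. For example, a stick joining a 4-valent vertex to a 2-valent vertex has $d=3+1=4$. *)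

theory Defs
  imports "HOL-Analysis.Analysis" "Graph_Theory.Digraph"
begin

text \<open>
  A finite multigraph (loops and parallel edges allowed) is a \<^locale>\<open>fin_digraph\<close>. The
  orientation of an edge only fixes the direction in which the curve drawing it is parametrised.
\<close>

record ('v, 'e, 'a) drawing =
  graph :: "('v, 'e) pre_digraph"
  pos :: "'v \<Rightarrow> 'a"
  curve :: "'e \<Rightarrow> real \<Rightarrow> 'a"

definition is_drawing :: "('v, 'e, 'a::topological_space, 'z) drawing_scheme \<Rightarrow> bool" where
  "is_drawing G \<longleftrightarrow> fin_digraph (graph G) \<and>
     (\<forall>e \<in> arcs (graph G). path (curve G e) \<and>
        pathstart (curve G e) = pos G (tail (graph G) e) \<and>
        pathfinish (curve G e) = pos G (head (graph G) e))"

text \<open>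
  The interior points of the edges of the topological realisation of the graph, each given by an
  edge and a parameter, and the map that places them.
\<close>

definition strands :: "('v, 'e, 'a, 'z) drawing_scheme \<Rightarrow> ('e \<times> real) set" where
  "strands G = arcs (graph G) \<times> {0<..<1}"

definition place :: "('v, 'e, 'a, 'z) drawing_scheme \<Rightarrow> 'e \<times> real \<Rightarrow> 'a" where
  "place G s = curve G (fst s) (snd s)"


section \<open>Spatial graphs\<close>

text \<open>
  The realisation of a finite graph is compact, so an embedding is a continuous injection of it.
  No tameness is imposed here: it is a consequence of having a diagram.
\<close>

definition spatial_graph :: "('v, 'e, real^3) drawing \<Rightarrow> bool" where
  "spatial_graph G \<longleftrightarrow> is_drawing G \<and>
     inj_on (pos G) (verts (graph G)) \<and>
     inj_on (place G) (strands G) \<and>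
     pos G ` verts (graph G) \<inter> place G ` strands G = {}"

text \<open>Edges are compared as subsets of space, not as parametrised curves.\<close>

definition ambient_isotopic ::
    "('v, 'e, real^3) drawing \<Rightarrow> ('v, 'e, real^3) drawing \<Rightarrow> bool" where
  "ambient_isotopic G G' \<longleftrightarrow> graph G = graph G' \<and>
     (\<exists>H :: real \<times> (real^3) \<Rightarrow> real^3.
        continuous_on ({0..1} \<times> UNIV) H \<and>
        (\<forall>x. H (0, x) = x) \<and>
        (\<forall>t \<in> {0..1}. \<exists>g. homeomorphism UNIV UNIV (\<lambda>x. H (t, x)) g) \<and>
        (\<forall>v \<in> verts (graph G). H (1, pos G v) = pos G' v) \<and>
        (\<forall>e \<in> arcs (graph G).
           (\<lambda>x. H (1, x)) ` path_image (curve G e) = path_image (curve G' e)))"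


section \<open>Spatial graph diagrams\<close>

text \<open>
  The field \<open>over\<close> decorates the crossings: \<open>over D s s'\<close> says that strand \<open>s\<close> passes over
  strand \<open>s'\<close>. It carries information only where two distinct strands are placed at one point.
\<close>

record ('v, 'e) diagram = "('v, 'e, real^2) drawing" +
  over :: "'e \<times> real \<Rightarrow> 'e \<times> real \<Rightarrow> bool"

definition crosses ::
    "('v, 'e, 'a, 'z) drawing_scheme \<Rightarrow> 'e \<times> real \<Rightarrow> 'e \<times> real \<Rightarrow> bool" where
  "crosses D s s' \<longleftrightarrow>
     s \<in> strands D \<and> s' \<in> strands D \<and> s \<noteq> s' \<and> place D s = place D s'"

definition crossings :: "('v, 'e, 'a, 'z) drawing_scheme \<Rightarrow> 'a set" where
  "crossings D = {place D s | s. \<exists>s'. crosses D s s'}"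

definition tangent ::
    "('v, 'e, 'a::real_normed_vector, 'z) drawing_scheme \<Rightarrow> 'e \<times> real \<Rightarrow> 'a" where
  "tangent D s = vector_derivative (curve D (fst s)) (at (snd s))"

definition regular_strand ::
    "('v, 'e, 'a::real_normed_vector, 'z) drawing_scheme \<Rightarrow> 'e \<times> real \<Rightarrow> bool" where
  "regular_strand D s \<longleftrightarrow>
     (\<exists>\<epsilon>>0. curve D (fst s) C1_differentiable_on {snd s - \<epsilon><..<snd s + \<epsilon>}) \<and> tangent D s \<noteq> 0"

text \<open>
  Edges are piecewise \<open>C\<^sup>1\<close> immersed, which covers both smooth and polygonal diagrams. At the
  finitely many corners the curve is still locally injective, since there are only finitely many
  multiple points and each has exactly two preimages. Crossings do not occur at corners, and
  transversality means that the two tangent lines span the plane.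
\<close>

definition is_diagram :: "('v, 'e, 'z) diagram_scheme \<Rightarrow> bool" where
  "is_diagram D \<longleftrightarrow> is_drawing D \<and>
     inj_on (pos D) (verts (graph D)) \<and>
     pos D ` verts (graph D) \<inter> place D ` strands D = {} \<and>
     finite {s \<in> strands D. \<not> regular_strand D s} \<and>
     finite (crossings D) \<and>
     (\<forall>p \<in> crossings D. card {s \<in> strands D. place D s = p} = 2) \<and>
     (\<forall>s s'. crosses D s s' \<longrightarrow>
        regular_strand D s \<and> regular_strand D s' \<and> span {tangent D s, tangent D s'} = UNIV \<and>
        (over D s s' \<longleftrightarrow> \<not> over D s' s))"

definition project :: "real^3 \<Rightarrow> real^2" where
  "project x = vector [x $ 1, x $ 2]"

text \<open>
  A diagram presents the spatial graphs that project onto it along the third coordinate axis with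
  heights at the crossings as decorated; these are all ambient isotopic to each other.
\<close>

definition projects_to ::
    "('v, 'e, real^3) drawing \<Rightarrow> ('v, 'e, 'z) diagram_scheme \<Rightarrow> bool" where
  "projects_to G D \<longleftrightarrow> graph G = graph D \<and>
     (\<forall>v \<in> verts (graph D). project (pos G v) = pos D v) \<and>
     (\<forall>e \<in> arcs (graph D). \<forall>t \<in> {0..1}. project (curve G e t) = curve D e t) \<and>
     (\<forall>s s'. crosses D s s' \<longrightarrow> (over D s s' \<longleftrightarrow> place G s $ 3 > place G s' $ 3))"

definition diagram_of ::
    "('v, 'e, 'z) diagram_scheme \<Rightarrow> ('v, 'e, real^3) drawing \<Rightarrow> bool" where
  "diagram_of D G \<longleftrightarrow> is_diagram D \<and>
     (\<exists>G'. spatial_graph G' \<and> projects_to G' D \<and> ambient_isotopic G' G)"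

definition crossing_number :: "('v, 'e, real^3) drawing \<Rightarrow> nat" where
  "crossing_number G =
     (LEAST n. \<exists>D :: ('v, 'e) diagram. diagram_of D G \<and> card (crossings D) = n)"


section \<open>Planar stick diagrams\<close>

text \<open>
  The field \<open>joints\<close> is the set of degree-2 vertices subdividing the edges of the graph, each
  given by the strand at which it is inserted.
\<close>

record ('v, 'e) stick_diagram = "('v, 'e) diagram" +
  joints :: "('e \<times> real) set"

definition nodes :: "('v, 'e) stick_diagram \<Rightarrow> 'e \<Rightarrow> real set" where
  "nodes D e = {0, 1} \<union> {t. (e, t) \<in> joints D}"

text \<open>
  The edges of the subdivided graph: \<open>(e, a, b)\<close> is the part of \<open>e\<close> between the consecutive
  subdivision parameters \<open>a\<close> and \<open>b\<close>.
\<close>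

definition sticks :: "('v, 'e) stick_diagram \<Rightarrow> ('e \<times> real \<times> real) set" where
  "sticks D = {(e, a, b). e \<in> arcs (graph D) \<and> a \<in> nodes D e \<and> b \<in> nodes D e \<and> a < b \<and>
                 nodes D e \<inter> {a<..<b} = {}}"

fun stick_ends :: "('v, 'e) stick_diagram \<Rightarrow> 'e \<times> real \<times> real \<Rightarrow> (real^2) set" where
  "stick_ends D (e, a, b) = {curve D e a, curve D e b}"

definition planar_stick_diagram_of ::
    "('v, 'e) stick_diagram \<Rightarrow> ('v, 'e, real^3) drawing \<Rightarrow> bool" where
  "planar_stick_diagram_of D G \<longleftrightarrow> diagram_of D G \<and>
     finite (joints D) \<and> joints D \<subseteq> strands D \<and>
     (\<forall>s \<in> joints D. \<forall>s'. \<not> crosses D s s') \<and>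
     (\<forall>(e, a, b) \<in> sticks D.
        bij_betw (curve D e) {a..b} (closed_segment (curve D e a) (curve D e b)))"

definition planar_stick_index :: "('v, 'e, real^3) drawing \<Rightarrow> nat" where
  "planar_stick_index G =
     (LEAST n. \<exists>D :: ('v, 'e) stick_diagram. planar_stick_diagram_of D G \<and> card (sticks D) = n)"

text \<open>Distinct vertices of a diagram have distinct images, so a common end is a common vertex.\<close>

definition adjacent_sticks ::
    "('v, 'e) stick_diagram \<Rightarrow> 'e \<times> real \<times> real \<Rightarrow> ('e \<times> real \<times> real) set" where
  "adjacent_sticks D s = {s' \<in> sticks D. s' \<noteq> s \<and> stick_ends D s \<inter> stick_ends D s' \<noteq> {}}"

definition num_sticks_with :: "('v, 'e) stick_diagram \<Rightarrow> nat \<Rightarrow> nat" where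
  "num_sticks_with D d = card {s \<in> sticks D. card (adjacent_sticks D s) = d}"

end

theory Submission
  imports Defs
begin

text \<open>
  Every crossing of \<open>D\<close> lies in the interior of two sticks. Transversality forces two sticks
  through a crossing to have no other common point, since otherwise they would be collinear. Hence
  the two sticks are distinct and not adjacent, and they determine the crossing. A stick with \<open>d\<close>
  neighbours therefore carries at most \<open>card (sticks D) - d - 1\<close> crossings, and summing over all
  sticks counts every crossing twice.
\<close>

text \<open>The minimum in \<open>crossing_number\<close> ranges over plain \<open>diagram\<close>
  records, while the bound is applied to a stick diagram, which has a further field. Truncation
  discards such fields, and none of the notions involved reads them.\<close>

lemma crossing_number_le:
  fixes D :: "('v, 'e, 'z) diagram_scheme"
  assumes "diagram_of D G"
  shows "crossing_number G \<le> card (crossings D)"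
proof -
  let ?D = "diagram.truncate D"
  have "diagram_of ?D G"
    using assms
    unfolding diagram_of_def is_diagram_def is_drawing_def projects_to_def crosses_def crossings_def
      strands_def place_def[abs_def] tangent_def regular_strand_def diagram.truncate_def
      drawing.select_convs diagram.select_convs .
  moreover have "crossings ?D = crossings D"
    by (simp add: crossings_def crosses_def strands_def place_def diagram.truncate_def)
  ultimately show ?thesis
    unfolding crossing_number_def by (intro Least_le) metis
qed

section \<open>Tangents of curves that stay in a segment\<close>

lemma regular_strand_has_tangent:
  assumes "regular_strand D s"
  shows "(curve D (fst s) has_vector_derivative tangent D s) (at (snd s))"
  using assms vector_derivative_works
  by (force simp: regular_strand_def tangent_def C1_differentiable_on_eq)

text \<open>The difference quotients lie in \<open>V\<close> near \<open>t\<close>, and a closed set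
  contains their limit.\<close>

lemma has_vector_derivative_in_closed_subspace:
  fixes f :: "real \<Rightarrow> 'a::real_normed_vector"
  assumes f: "(f has_vector_derivative d) (at t)"
    and V: "subspace V" "closed V"
    and ev: "\<forall>\<^sub>F u in at t. f u - f t \<in> V"
  shows "d \<in> V"
proof (rule Lim_in_closed_set[OF V(2)])
  show "((\<lambda>u. (f u - f t) /\<^sub>R (u - t)) \<longlongrightarrow> d) (at t)"
  proof -
    \<comment> \<open>The derivative divides by \<open>norm (u - t)\<close>, the difference quotient
      by \<open>u - t\<close>. The two differ by a sign only, so the limits are compared after
      taking norms.\<close>
    have "((\<lambda>u. (f u - f t - (u - t) *\<^sub>R d) /\<^sub>R norm (u - t)) \<longlongrightarrow> 0) (at t)"
      using f by (simp add: has_vector_derivative_def has_derivative_at_within)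
    then have "((\<lambda>u. norm ((f u - f t) /\<^sub>R (u - t) - d)) \<longlongrightarrow> 0) (at t)"
      unfolding tendsto_norm_zero_iff[symmetric, of "\<lambda>u. (f u - f t - (u - t) *\<^sub>R d) /\<^sub>R norm (u - t)"]
    proof (rule Lim_transform_eventually)
      show "\<forall>\<^sub>F u in at t. norm ((f u - f t - (u - t) *\<^sub>R d) /\<^sub>R norm (u - t)) =
          norm ((f u - f t) /\<^sub>R (u - t) - d)"
      proof (rule eventually_mono[OF eventually_neq_at_within[of t]])
        fix u assume "u \<noteq> t"
        then have "(f u - f t) /\<^sub>R (u - t) - d = (f u - f t - (u - t) *\<^sub>R d) /\<^sub>R (u - t)"
          by (simp add: scaleR_right_diff_distrib)
        then show "norm ((f u - f t - (u - t) *\<^sub>R d) /\<^sub>R norm (u - t)) =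
            norm ((f u - f t) /\<^sub>R (u - t) - d)"
          by simp
      qed
    qed
    then show ?thesis
      by (simp add: tendsto_norm_zero_iff LIM_zero_iff)
  qed
  show "\<forall>\<^sub>F u in at t. (f u - f t) /\<^sub>R (u - t) \<in> V"
    using ev by (rule eventually_mono) (simp add: subspace_scale[OF V(1)])
qed simp

text \<open>Every difference of two points of the segment is a multiple of \<open>Q - P\<close>, and
  for \<open>x - y\<close> the factor is nonzero.\<close>

lemma diff_closed_segment_in_span:
  fixes P Q :: "'a::real_vector"
  assumes "w \<in> closed_segment P Q" "z \<in> closed_segment P Q"
    and "x \<in> closed_segment P Q" "y \<in> closed_segment P Q" "x \<noteq> y"
  shows "w - z \<in> span {x - y}"
proof -
  have *: "\<exists>r. u - v = r *\<^sub>R (Q - P)" if uv: "u \<in> closed_segment P Q" "v \<in> closed_segment P Q" for u v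
  proof -
    obtain k l where kl: "u = (1 - k) *\<^sub>R P + k *\<^sub>R Q" "v = (1 - l) *\<^sub>R P + l *\<^sub>R Q"
      using uv unfolding in_segment by blast
    have "u - v = (k - l) *\<^sub>R (Q - P)"
      by (simp add: kl algebra_simps)
    then show ?thesis ..
  qed
  obtain r q where r: "w - z = r *\<^sub>R (Q - P)" and q: "x - y = q *\<^sub>R (Q - P)"
    using * assms by meson
  have "q \<noteq> 0"
    using q assms(5) by auto
  then have "w - z = (r / q) *\<^sub>R (x - y)"
    by (simp add: r q)
  then show ?thesis
    by (simp add: span_breakdown_eq)
qed

text \<open>The direction is given by two arbitrary distinct points of the segment rather than by
  its ends. For two segments sharing \<open>x\<close> and \<open>y\<close>, both tangents then land
  in the same line.\<close>

lemma derivative_along_segment_in_span: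
  fixes c :: "real \<Rightarrow> 'a::euclidean_space"
  assumes "c ` {a..b} \<subseteq> closed_segment P Q" "a < t" "t < b"
    and "(c has_vector_derivative d) (at t)"
    and "x \<in> closed_segment P Q" "y \<in> closed_segment P Q" "x \<noteq> y"
  shows "d \<in> span {x - y}"
proof (rule has_vector_derivative_in_closed_subspace[OF assms(4)])
  have "\<forall>\<^sub>F u in at t. u \<in> {a<..<b}"
    using assms(2,3) by (intro eventually_at_in_open') auto
  then show "\<forall>\<^sub>F u in at t. c u - c t \<in> span {x - y}"
  proof (rule eventually_mono)
    fix u assume "u \<in> {a<..<b}"
    then have "c u \<in> closed_segment P Q" "c t \<in> closed_segment P Q"
      using assms(1-3) by (auto simp: image_subset_iff)
    then show "c u - c t \<in> span {x - y}"
      using assms(5-7) by (rule diff_closed_segment_in_span)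
  qed
qed (simp_all add: closed_subspace)

lemma span_pair_neq_UNIV:
  fixes u v w :: "real^2"
  assumes "u \<in> span {w}" "v \<in> span {w}"
  shows "span {u, v} \<noteq> UNIV"
proof
  assume "span {u, v} = UNIV"
  moreover have "span {u, v} \<subseteq> span {w}"
    using assms by (intro span_minimal) auto
  ultimately have "span {w} = UNIV"
    by auto
  then have "dim {w} = 2"
    by (subst dim_span[symmetric]) simp
  moreover have "dim {w} \<le> 1"
    using dim_le_card[of "{w}" "{w}"] by (simp add: span_superset)
  ultimately show False
    by simp
qed

text \<open>The inequalities are strict: a strand on a stick lies in its interior, never at an
  end.\<close>

fun on_stick :: "'e \<times> real \<Rightarrow> 'e \<times> real \<times> real \<Rightarrow> bool" where
  "on_stick (e', t) (e, a, b) \<longleftrightarrow> e' = e \<and> a < t \<and> t < b"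

fun stick_segment :: "('v, 'e) stick_diagram \<Rightarrow> 'e \<times> real \<times> real \<Rightarrow> (real^2) set" where
  "stick_segment D (e, a, b) = closed_segment (curve D e a) (curve D e b)"

lemma stick_ends_subset_segment: "stick_ends D \<sigma> \<subseteq> stick_segment D \<sigma>"
  by (cases \<sigma>) auto

section \<open>Geometry of crossing sticks\<close>

context
  fixes D :: "('v, 'e) stick_diagram" and G :: "('v, 'e, real^3) drawing"
  assumes D: "planar_stick_diagram_of D G"
begin

lemma is_diagram_D: "is_diagram D"
  using D by (simp add: planar_stick_diagram_of_def diagram_of_def)

lemma finite_arcs_D: "finite (arcs (graph D))"
  using is_diagram_D by (simp add: is_diagram_def is_drawing_def fin_digraph.finite_arcs)

lemma stick_bij:
  assumes "(e, a, b) \<in> sticks D"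
  shows "bij_betw (curve D e) {a..b} (closed_segment (curve D e a) (curve D e b))"
  using D assms by (auto simp: planar_stick_diagram_of_def)

lemma finite_nodes: "finite (nodes D e)"
proof -
  have "finite (snd ` joints D)"
    using D by (simp add: planar_stick_diagram_of_def)
  moreover have "{t. (e, t) \<in> joints D} \<subseteq> snd ` joints D"
    by force
  ultimately show ?thesis
    by (simp add: nodes_def finite_subset)
qed

lemma finite_sticks: "finite (sticks D)"
proof (rule finite_subset)
  show "sticks D \<subseteq> (SIGMA e:arcs (graph D). nodes D e \<times> nodes D e)"
    by (auto simp: sticks_def)
  show "finite (SIGMA e:arcs (graph D). nodes D e \<times> nodes D e)"
    using finite_arcs_D finite_nodes by blast
qed

lemma crosses_regular:
  assumes "crosses D s s'"
  shows "regular_strand D s" "regular_strand D s'" "span {tangent D s, tangent D s'} = UNIV"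
  using is_diagram_D assms unfolding is_diagram_def by blast+

text \<open>Crossings avoid joints, and strand parameters avoid 0 and 1, so the parameter of
  \<open>s\<close> is not a node. The nearest nodes on either side bound the required stick.\<close>

lemma crossing_strand_on_stick:
  assumes "crosses D s s'"
  obtains \<sigma> where "\<sigma> \<in> sticks D" "on_stick s \<sigma>"
proof -
  obtain e t where s: "s = (e, t)"
    by (cases s)
  let ?L = "{x \<in> nodes D e. x < t}" and ?U = "{x \<in> nodes D e. t < x}"
  have e: "e \<in> arcs (graph D)" and t: "0 < t" "t < 1"
    using assms by (auto simp: crosses_def strands_def s)
  have "s \<notin> joints D"
    using D assms unfolding planar_stick_diagram_of_def by blast
  then have "t \<notin> nodes D e"
    using t by (auto simp: nodes_def s)
  have fin: "finite ?L" "finite ?U"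
    using finite_nodes by auto
  have "0 \<in> ?L" "1 \<in> ?U"
    using t by (auto simp: nodes_def)
  then have "Max ?L \<in> ?L" "Min ?U \<in> ?U"
    using fin by (intro Max_in Min_in; blast)+
  \<comment> \<open>This makes the two chosen nodes consecutive.\<close>
  moreover have "x \<le> Max ?L \<or> Min ?U \<le> x" if "x \<in> nodes D e" for x
  proof (cases "x < t")
    case True
    then show ?thesis
      using that fin by (simp add: Max_ge)
  next
    case False
    then have "x \<in> ?U"
      using that \<open>t \<notin> nodes D e\<close> by (cases "x = t") auto
    then show ?thesis
      using fin by (simp add: Min_le)
  qed
  ultimately have "(e, Max ?L, Min ?U) \<in> sticks D" "on_stick s (e, Max ?L, Min ?U)"
    using e by (fastforce simp: sticks_def s)+
  then show thesis
    by (rule that)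
qed

lemma place_in_stick_segment:
  assumes "\<sigma> \<in> sticks D" "on_stick s \<sigma>"
  shows "place D s \<in> stick_segment D \<sigma>"
proof -
  obtain e a b t where "\<sigma> = (e, a, b)" "s = (e, t)" "a < t" "t < b"
    using assms(2) by (cases \<sigma>; cases s) auto
  then show ?thesis
    using stick_bij[of e a b] assms(1) by (auto simp: place_def dest: bij_betwE)
qed

lemma place_inj_on_stick:
  assumes "\<sigma> \<in> sticks D" "on_stick s \<sigma>" "on_stick s' \<sigma>" "place D s = place D s'"
  shows "s = s'"
proof -
  obtain e a b t t' where "\<sigma> = (e, a, b)" "s = (e, t)" "s' = (e, t')" "t \<in> {a..b}" "t' \<in> {a..b}"
    using assms(2,3) by (cases \<sigma>; cases s; cases s') auto
  then show ?thesis
    using stick_bij[of e a b] assms(1,4) by (auto simp: place_def bij_betw_def dest: inj_onD)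
qed

lemma place_notin_stick_ends:
  assumes "\<sigma> \<in> sticks D" "on_stick s \<sigma>"
  shows "place D s \<notin> stick_ends D \<sigma>"
proof -
  obtain e a b t where *: "\<sigma> = (e, a, b)" "s = (e, t)" "a < t" "t < b"
    using assms(2) by (cases \<sigma>; cases s) auto
  then have "inj_on (curve D e) {a..b}"
    using stick_bij[of e a b] assms(1) by (simp add: bij_betw_def)
  then show ?thesis
    using * by (auto simp: place_def dest: inj_onD)
qed

lemma tangent_in_span:
  assumes "\<sigma> \<in> sticks D" "on_stick s \<sigma>" "regular_strand D s"
    and "x \<in> stick_segment D \<sigma>" "y \<in> stick_segment D \<sigma>" "x \<noteq> y"
  shows "tangent D s \<in> span {x - y}"
proof -
  obtain e a b t where *: "\<sigma> = (e, a, b)" "s = (e, t)" "a < t" "t < b"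
    using assms(2) by (cases \<sigma>; cases s) auto
  have "curve D e ` {a..b} \<subseteq> closed_segment (curve D e a) (curve D e b)"
    using stick_bij[of e a b] assms(1) * by (simp add: bij_betw_def)
  then show ?thesis
    using regular_strand_has_tangent[OF assms(3)] assms(4-6) *
    by (intro derivative_along_segment_in_span[where c = "curve D e"]) auto
qed

text \<open>A second common point would put both tangents in one line, against transversality.
  Segments are taken with their ends, so that \<open>z\<close> may be a shared vertex as well as
  another crossing.\<close>

lemma crossing_sticks_meet_once:
  assumes c: "crosses D s s'"
    and \<sigma>: "\<sigma> \<in> sticks D" "on_stick s \<sigma>" and \<tau>: "\<tau> \<in> sticks D" "on_stick s' \<tau>"
    and z: "z \<in> stick_segment D \<sigma>" "z \<in> stick_segment D \<tau>"
  shows "z = place D s"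
proof (rule ccontr)
  assume ne: "z \<noteq> place D s"
  have eq: "place D s = place D s'"
    using c by (simp add: crosses_def)
  have "tangent D s \<in> span {z - place D s}"
    using \<sigma> crosses_regular(1)[OF c] z(1) place_in_stick_segment[OF \<sigma>] ne by (rule tangent_in_span)
  moreover have "tangent D s' \<in> span {z - place D s}"
    using \<tau> crosses_regular(2)[OF c] z(2) place_in_stick_segment[OF \<tau>, folded eq] ne
    by (rule tangent_in_span)
  ultimately show False
    using span_pair_neq_UNIV crosses_regular(3)[OF c] by blast
qed

text \<open>A stick is drawn injectively, so it cannot cross itself. A shared end would be the
  crossing itself, which lies in the interior of \<sigma>.\<close>

lemma crossing_sticks_not_adjacent:
  assumes c: "crosses D s s'"
    and \<sigma>: "\<sigma> \<in> sticks D" "on_stick s \<sigma>" and \<tau>: "\<tau> \<in> sticks D" "on_stick s' \<tau>"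
  shows "\<tau> \<noteq> \<sigma>" "\<tau> \<notin> adjacent_sticks D \<sigma>"
proof -
  show "\<tau> \<noteq> \<sigma>"
    using place_inj_on_stick[OF \<sigma>, of s'] c \<tau>(2) by (auto simp: crosses_def)
  have "place D s \<in> stick_ends D \<sigma>" if "z \<in> stick_ends D \<sigma>" "z \<in> stick_ends D \<tau>" for z
    using crossing_sticks_meet_once[OF c \<sigma> \<tau>, of z] that stick_ends_subset_segment by blast
  then show "\<tau> \<notin> adjacent_sticks D \<sigma>"
    using place_notin_stick_ends[OF \<sigma>] by (auto simp: adjacent_sticks_def)
qed

text \<open>Sending each crossing strand on \<sigma> to a stick through its partner is injective and
  avoids \<sigma> and its neighbours. The summand 1 accounts for \<sigma>; the additive form avoids
  truncated subtraction.\<close>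

lemma card_crossings_on_stick:
  assumes \<sigma>: "\<sigma> \<in> sticks D"
  shows "card {s. on_stick s \<sigma> \<and> (\<exists>s'. crosses D s s')} + card (adjacent_sticks D \<sigma>) + 1
    \<le> card (sticks D)"
proof -
  let ?A = "{s. on_stick s \<sigma> \<and> (\<exists>s'. crosses D s s')}"
  let ?N = "insert \<sigma> (adjacent_sticks D \<sigma>)"
  have "\<exists>s' \<tau>. crosses D s s' \<and> \<tau> \<in> sticks D \<and> on_stick s' \<tau>" if s: "s \<in> ?A" for s
  proof -
    obtain s' where s': "crosses D s s'"
      using s by blast
    then have "crosses D s' s"
      by (auto simp: crosses_def)
    then show ?thesis
      using s' crossing_strand_on_stick by metis
  qed
  then obtain f g where fg: "\<And>s. s \<in> ?A \<Longrightarrow> crosses D s (f s) \<and> g s \<in> sticks D \<and> on_stick (f s) (g s)"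
    by metis
  have "inj_on g ?A"
  proof (rule inj_onI)
    fix s\<^sub>1 s\<^sub>2 assume A: "s\<^sub>1 \<in> ?A" "s\<^sub>2 \<in> ?A" and g: "g s\<^sub>1 = g s\<^sub>2"
    \<comment> \<open>Both crossings lie on \<sigma> and on the stick assigned to both strands, and
      these two sticks meet only once.\<close>
    have "place D s\<^sub>2 \<in> stick_segment D \<sigma>"
      using place_in_stick_segment[OF \<sigma>] A by blast
    moreover have "place D s\<^sub>2 \<in> stick_segment D (g s\<^sub>1)"
      using place_in_stick_segment[of "g s\<^sub>2" "f s\<^sub>2"] fg[OF A(2)] g by (simp add: crosses_def)
    ultimately have "place D s\<^sub>2 = place D s\<^sub>1"
      using crossing_sticks_meet_once[of s\<^sub>1 "f s\<^sub>1" \<sigma> "g s\<^sub>1"] \<sigma> A fg[OF A(1)] by blast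
    then show "s\<^sub>1 = s\<^sub>2"
      using place_inj_on_stick[OF \<sigma>] A by simp
  qed
  moreover have "g ` ?A \<subseteq> sticks D - ?N"
    using crossing_sticks_not_adjacent[OF _ \<sigma>] fg by blast
  ultimately have "card ?A \<le> card (sticks D - ?N)"
    using finite_sticks by (intro card_inj_on_le[of g]) auto
  moreover have N: "?N \<subseteq> sticks D"
    using \<sigma> by (auto simp: adjacent_sticks_def)
  moreover have fin: "finite ?N"
    using N finite_sticks by (rule finite_subset)
  moreover have "card ?N = card (adjacent_sticks D \<sigma>) + 1"
    using fin by (subst card_insert_disjoint) (auto simp: adjacent_sticks_def)
  ultimately show ?thesis
    using card_mono[OF finite_sticks N] by (simp add: card_Diff_subset)
qed

section \<open>Double counting\<close>

lemma twice_card_crossings: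
  "2 * card (crossings D) = card {s. \<exists>s'. crosses D s s'}"
proof -
  \<comment> \<open>The crossing strands split into the fibres of \<open>place\<close> over the
    crossings, each of size two.\<close>
  let ?F = "\<lambda>p. {s \<in> strands D. place D s = p}"
  have two: "card (?F p) = 2" if "p \<in> crossings D" for p
    using is_diagram_D that by (simp add: is_diagram_def)
  have "\<exists>s'. crosses D s s'" if "p \<in> crossings D" "s \<in> ?F p" for p s
  proof -
    obtain s\<^sub>1 s\<^sub>2 where "crosses D s\<^sub>1 s\<^sub>2" "place D s\<^sub>1 = p"
      using \<open>p \<in> crossings D\<close> by (auto simp: crossings_def)
    \<comment> \<open>At least one of the two witnesses differs from \<open>s\<close> and serves as
      its partner.\<close>
    then have "crosses D s (if s = s\<^sub>1 then s\<^sub>2 else s\<^sub>1)"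
      using \<open>s \<in> ?F p\<close> by (auto simp: crosses_def)
    then show ?thesis ..
  qed
  moreover have "s \<in> strands D \<and> place D s \<in> crossings D" if "crosses D s s'" for s s'
    using that unfolding crossings_def crosses_def by blast
  ultimately have "{s. \<exists>s'. crosses D s s'} = (\<Union>p\<in>crossings D. ?F p)"
    by blast
  also have "card \<dots> = (\<Sum>p\<in>crossings D. card (?F p))"
  proof (rule card_UN_disjoint)
    show "finite (crossings D)"
      using is_diagram_D by (simp add: is_diagram_def)
    show "\<forall>p\<in>crossings D. finite (?F p)"
      \<comment> \<open>An infinite set has \<open>card\<close> 0, so cardinality 2 forces
        finiteness.\<close>
      using two by (simp add: card_ge_0_finite)
  qed auto
  finally show ?thesis
    using two by simp
qed

text \<open>The sticks cover all crossing strands, so a union bound combines the bounds for single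
  sticks. The passage to reals makes the subtraction exact.\<close>

lemma twice_card_crossings_le:
  "2 * real (card (crossings D)) \<le>
    (\<Sum>\<sigma>\<in>sticks D. real (card (sticks D)) - real (card (adjacent_sticks D \<sigma>)) - 1)"
proof -
  let ?A = "\<lambda>\<sigma>. {s. on_stick s \<sigma> \<and> (\<exists>s'. crosses D s s')}"
  have "{s. \<exists>s'. crosses D s s'} = (\<Union>\<sigma>\<in>sticks D. ?A \<sigma>)"
  proof
    show "{s. \<exists>s'. crosses D s s'} \<subseteq> (\<Union>\<sigma>\<in>sticks D. ?A \<sigma>)"
    proof
      fix s assume s: "s \<in> {s. \<exists>s'. crosses D s s'}"
      then obtain \<sigma> where "\<sigma> \<in> sticks D" "on_stick s \<sigma>"
        using crossing_strand_on_stick by blast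
      with s show "s \<in> (\<Union>\<sigma>\<in>sticks D. ?A \<sigma>)"
        by blast
    qed
  qed blast
  then have "2 * card (crossings D) \<le> (\<Sum>\<sigma>\<in>sticks D. card (?A \<sigma>))"
    unfolding twice_card_crossings using card_UN_le[OF finite_sticks] by simp
  then have "real (2 * card (crossings D)) \<le> real (\<Sum>\<sigma>\<in>sticks D. card (?A \<sigma>))"
    by (rule of_nat_mono)
  then have "2 * real (card (crossings D)) \<le> (\<Sum>\<sigma>\<in>sticks D. real (card (?A \<sigma>)))"
    unfolding of_nat_sum by simp
  also have "\<dots> \<le> (\<Sum>\<sigma>\<in>sticks D. real (card (sticks D)) - real (card (adjacent_sticks D \<sigma>)) - 1)"
    using card_crossings_on_stick by (intro sum_mono) fastforce
  finally show ?thesis .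
qed

text \<open>Only finitely many degrees occur, so the series is a finite sum, which regroups the
  sticks by their number of neighbours.\<close>

lemma suminf_num_sticks_with:
  fixes h :: "nat \<Rightarrow> real"
  shows "(\<Sum>d. real (num_sticks_with D d) * h d) = (\<Sum>\<sigma>\<in>sticks D. h (card (adjacent_sticks D \<sigma>)))"
proof -
  let ?deg = "\<lambda>\<sigma>. card (adjacent_sticks D \<sigma>)"
  have "(\<Sum>d. real (num_sticks_with D d) * h d) =
      (\<Sum>d\<in>?deg ` sticks D. real (num_sticks_with D d) * h d)"
    using finite_sticks
    by (intro suminf_finite) (auto simp: num_sticks_with_def card_eq_0_iff)
  also have "\<dots> = (\<Sum>d\<in>?deg ` sticks D. \<Sum>\<sigma>\<in>{\<sigma> \<in> sticks D. ?deg \<sigma> = d}. h (?deg \<sigma>))"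
    by (simp add: num_sticks_with_def)
  also have "\<dots> = (\<Sum>\<sigma>\<in>sticks D. h (?deg \<sigma>))"
    using finite_sticks by (intro sum.group) auto
  finally show ?thesis .
qed

end

theorem theorem3p2:
  fixes G :: "('v, 'e, real^3) drawing" and D :: "('v, 'e) stick_diagram"
  assumes "spatial_graph G"
    and "planar_stick_diagram_of D G"
    and "card (sticks D) = planar_stick_index G"
  shows "real (crossing_number G) \<le>
    1 / 2 * (\<Sum>d. real (num_sticks_with D d) * (real (planar_stick_index G) - real d - 1))"
proof -
  have "crossing_number G \<le> card (crossings D)"
    using assms(2) by (intro crossing_number_le) (simp add: planar_stick_diagram_of_def)
  \<comment> \<open>The regrouping is used with \<open>h d\<close> equal to the stick index minus
    \<open>d\<close> minus 1.\<close>
  then show ?thesis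
    using twice_card_crossings_le[OF assms(2)] suminf_num_sticks_with[OF assms(2)]
    by (simp add: assms(3))
qed

end
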